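(* Let $q$ be a prime power and $\ell = q^3$, and let $\mathbb{F}_\ell$ be the field with $\ell$ elements. Let $a_n, b_n, c_n$ ($n\ge 1$) and the fields $C_n$, $G_n$, $H_n$ ($n \ge 1$) be as defined in the context. Then for every integer $n\ge 2$ we have $H_n = C_n$.
   Context: Let $q$ be a prime power, $\ell=q^3$, and let $\mathbb{F}_\ell(a_1)$ be the rational function field in one variable $a_1$ over $\mathbb{F}_\ell$. All elements and fields below lie in one fixed algebraic closure of $\mathbb{F}_\ell(a_1)$. For each $n\ge 1$, let $a_{n+1}$ be an element satisfying $$\frac{1-a_{n+1}}{a_{n+1}^q} = \frac{a_n^q+a_n-1}{a_n}.$$ For each $n\ge 1$, let $c_n$ and $b_n$ be elements satisfying $$c_n^{q-1} = 1-\frac{1}{a_n}\qquad\text{and}\qquad b_n^{q-1} = -\frac{a_n^q+a_n-1}{a_n}.$$ (The elements $a_{n+1}, b_n, c_n$ are any choices of solutions of these equations.) Define $C_1=\mathbb{F}_\ell(c_1)$ and, for $n\ge 1$, $C_{n+1}=C_n(c_{n+1})$. Define $G_1=\mathbb{F}_\ell(a_1)$ and, for $n\ge 1$, $H_n=G_n(b_n)$ and $G_{n+1}=H_n(a_{n+1})$. The claim $H_n=C_n$ is an equality of subfields of the fixed algebraic closure. *)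

theory Defs
  imports "HOL-Algebra.Algebraic_Closure" "HOL-Algebra.Generated_Fields" "HOL-Number_Theory.Prime_Powers"
begin

(* K(x): the smallest subfield of L containing K and x (the library's simple_extension
   is only the ring K[x]). *)
definition adjoin :: "('a, 'm) ring_scheme \<Rightarrow> 'a set \<Rightarrow> 'a \<Rightarrow> 'a set"
  where "adjoin L K x = generate_field L (insert x K)"

(* The fields C_n, G_n, H_n are indexed from n = 1. Setting C_0 = F yields C_1 = F(c_1);
   G_0 = F is a dummy value on which no G_n or H_n with n >= 1 depends. *)
primrec tower_C :: "('a, 'm) ring_scheme \<Rightarrow> 'a set \<Rightarrow> (nat \<Rightarrow> 'a) \<Rightarrow> nat \<Rightarrow> 'a set"
  where
    "tower_C L F c 0 = F"
  | "tower_C L F c (Suc n) = adjoin L (tower_C L F c n) (c (Suc n))"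

fun tower_G :: "('a, 'm) ring_scheme \<Rightarrow> 'a set \<Rightarrow> (nat \<Rightarrow> 'a) \<Rightarrow> (nat \<Rightarrow> 'a) \<Rightarrow> nat \<Rightarrow> 'a set"
  and tower_H :: "('a, 'm) ring_scheme \<Rightarrow> 'a set \<Rightarrow> (nat \<Rightarrow> 'a) \<Rightarrow> (nat \<Rightarrow> 'a) \<Rightarrow> nat \<Rightarrow> 'a set"
  where
    "tower_G L F a b 0 = F"
  | "tower_G L F a b (Suc 0) = adjoin L F (a 1)"
  | "tower_G L F a b (Suc (Suc n)) = adjoin L (tower_H L F a b (Suc n)) (a (Suc (Suc n)))"
  | "tower_H L F a b n = adjoin L (tower_G L F a b n) (b n)"

end

(* Since F contains all (q-1)-st roots of unity, a field containing F contains x as soon as it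
   contains y with x^(q-1) = y^(q-1). The defining equations give two such relations between
   consecutive levels: c_{n+1} and b_n a_{n+1} have equal (q-1)-st powers, and, because
   (a_n - 1)^q = a_n^q - 1, so do b_{n+1} and c_n^q a_n a_{n+1}. The second relation puts b_n in C_n
   for n >= 2; at n = 1 it puts c_1^q, hence also c_1 = c_1^q / (1 - 1/a_1), in H_2. *)

theory Submission
  imports Defs
begin

section \<open>Prime characteristic\<close>

text \<open>Induction on \<open>n\<close>: the expansion for \<open>n\<close> is multiplied by
  \<open>x\<close> and by \<open>y\<close> separately, both sums are brought to the monomials
  \<open>x [^] Suc k \<otimes> y [^] (n - k)\<close>, and Pascal's rule adds the
  coefficients.\<close>

lemma (in cring) binomial_expansion:
  assumes x: "x \<in> carrier R" and y: "y \<in> carrier R"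
  shows "(x \<oplus> y) [^] n = (\<Oplus>k\<in>{..n}. [(n choose k)] \<cdot> (x [^] k \<otimes> y [^] (n - k)))"
proof (induction n)
  case 0
  show ?case by simp
next
  case (Suc n)
  let ?S = "\<Oplus>k\<in>{..n}. [(n choose k)] \<cdot> (x [^] k \<otimes> y [^] (n - k))"
  have X: "?S \<otimes> x = (\<Oplus>k\<in>{..n}. [(n choose k)] \<cdot> (x [^] Suc k \<otimes> y [^] (n - k)))"
  proof -
    have "?S \<otimes> x = (\<Oplus>k\<in>{..n}. [(n choose k)] \<cdot> (x [^] k \<otimes> y [^] (n - k)) \<otimes> x)"
      using x y by (intro finsum_ldistr) auto
    also have "\<dots> = (\<Oplus>k\<in>{..n}. [(n choose k)] \<cdot> (x [^] Suc k \<otimes> y [^] (n - k)))"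
      using x y by (intro finsum_cong') (auto simp: add_pow_ldistr add_pow_rdistr m_ac)
    finally show ?thesis .
  qed
  have "?S \<otimes> y = (\<Oplus>k\<in>{..n}. [(n choose k)] \<cdot> (x [^] k \<otimes> y [^] (Suc n - k)))"
  proof -
    have "?S \<otimes> y = (\<Oplus>k\<in>{..n}. [(n choose k)] \<cdot> (x [^] k \<otimes> y [^] (n - k)) \<otimes> y)"
      using x y by (intro finsum_ldistr) auto
    also have "\<dots> = (\<Oplus>k\<in>{..n}. [(n choose k)] \<cdot> (x [^] k \<otimes> y [^] (Suc n - k)))"
      using x y by (intro finsum_cong') (auto simp: add_pow_ldistr add_pow_rdistr m_ac Suc_diff_le)
    finally show ?thesis .
  qed
  \<comment> \<open>The added top term \<open>k = Suc n\<close> has coefficient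
    \<open>n choose Suc n = 0\<close>. Extending the range this way lets the bottom term be split
    off next, which shifts the index by one to match \<open>X\<close>.\<close>
  also have "\<dots> = (\<Oplus>k\<in>{..Suc n}. [(n choose k)] \<cdot> (x [^] k \<otimes> y [^] (Suc n - k)))"
    using x y by (subst finsum_Suc) (auto simp: binomial_eq_0)
  also have "\<dots> = (\<Oplus>k\<in>{..n}. [(n choose Suc k)] \<cdot> (x [^] Suc k \<otimes> y [^] (n - k))) \<oplus> y [^] Suc n"
    using x y by (subst finsum_Suc2) auto
  finally have Y: "?S \<otimes> y =
    (\<Oplus>k\<in>{..n}. [(n choose Suc k)] \<cdot> (x [^] Suc k \<otimes> y [^] (n - k))) \<oplus> y [^] Suc n" .
  have "(x \<oplus> y) [^] Suc n = ?S \<otimes> x \<oplus> ?S \<otimes> y"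
    using x y Suc.IH by (simp add: r_distr)
  also have "\<dots> = (\<Oplus>k\<in>{..n}. [(n choose k)] \<cdot> (x [^] Suc k \<otimes> y [^] (n - k)) \<oplus>
      [(n choose Suc k)] \<cdot> (x [^] Suc k \<otimes> y [^] (n - k))) \<oplus> y [^] Suc n"
    unfolding X Y using x y by (subst finsum_addf) (auto simp: a_assoc)
  also have "\<dots> = (\<Oplus>k\<in>{..n}. [(Suc n choose Suc k)] \<cdot> (x [^] Suc k \<otimes> y [^] (n - k))) \<oplus> y [^] Suc n"
    using x y by (simp add: add.nat_pow_mult)
  also have "\<dots> = (\<Oplus>k\<in>{..Suc n}. [(Suc n choose k)] \<cdot> (x [^] k \<otimes> y [^] (Suc n - k)))"
    using x y by (subst finsum_Suc2) (auto simp del: binomial_Suc_Suc)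
  finally show ?case .
qed

lemma (in cring) add_pow_dvd_eq_zero:
  assumes "[p] \<cdot> \<one> = \<zero>" "p dvd (n::nat)" "x \<in> carrier R"
  shows "[n] \<cdot> x = \<zero>"
proof -
  obtain m where n: "n = p * m" using assms(2) by auto
  have "[p] \<cdot> x = \<zero>"
    using assms add_pow_ldistr[of \<one> x p] by simp
  then show ?thesis
    using add.nat_pow_pow[of x m p] assms(3) by (simp add: n)
qed

text \<open>A prime \<open>p\<close> divides every binomial coefficient \<open>p choose k\<close>
  with \<open>0 < k < p\<close>, so in characteristic \<open>p\<close> only the two outer terms of
  the expansion survive.\<close>

lemma (in cring) freshmans_dream:
  assumes p: "Factorial_Ring.prime (p::nat)" "[p] \<cdot> \<one> = \<zero>"
    and x: "x \<in> carrier R" and y: "y \<in> carrier R"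
  shows "(x \<oplus> y) [^] p = x [^] p \<oplus> y [^] p"
proof -
  obtain m where m: "p = Suc (Suc m)"
    using prime_ge_2_nat[OF p(1)] by (metis add_2_eq_Suc le_Suc_ex)
  \<comment> \<open>With \<open>p = m + 2\<close>, the indices \<open>Suc k\<close> for
    \<open>k \<le> m\<close> are exactly the inner ones 1, ..., p - 1.\<close>
  have z: "[(p choose Suc k)] \<cdot> (x [^] Suc k \<otimes> y [^] (p - Suc k)) = \<zero>" if "k \<le> m" for k
    using that p x y m
    by (intro add_pow_dvd_eq_zero[OF p(2)] dvd_choose_prime) auto
  have "(x \<oplus> y) [^] p = (\<Oplus>k\<in>{..Suc (Suc m)}. [(p choose k)] \<cdot> (x [^] k \<otimes> y [^] (p - k)))"
    unfolding binomial_expansion[OF x y] by (simp add: m)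
  also have "\<dots> = x [^] p \<oplus>
      ((\<Oplus>k\<in>{..m}. [(p choose Suc k)] \<cdot> (x [^] Suc k \<otimes> y [^] (p - Suc k))) \<oplus> y [^] p)"
    using x y by (subst finsum_Suc, force, subst finsum_Suc2)
      (auto simp: m simp del: binomial_Suc_Suc nat_pow_Suc)
  also have "(\<Oplus>k\<in>{..m}. [(p choose Suc k)] \<cdot> (x [^] Suc k \<otimes> y [^] (p - Suc k))) = (\<Oplus>k\<in>{..m}. \<zero>)"
    using z by (intro finsum_cong') auto
  finally show ?thesis
    using x y by simp
qed

lemma (in cring) freshmans_dream_power:
  assumes "Factorial_Ring.prime (p::nat)" "[p] \<cdot> \<one> = \<zero>"
    and "x \<in> carrier R" "y \<in> carrier R"
  shows "(x \<oplus> y) [^] (p ^ n) = x [^] (p ^ n) \<oplus> y [^] (p ^ n)"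
proof (induction n)
  case (Suc n)
  have "(x \<oplus> y) [^] (p ^ n * p) = ((x \<oplus> y) [^] (p ^ n)) [^] p"
    using assms by (simp add: nat_pow_pow)
  also have "\<dots> = x [^] (p ^ n * p) \<oplus> y [^] (p ^ n * p)"
    using assms by (simp add: Suc.IH freshmans_dream nat_pow_pow)
  finally show ?case
    by (simp add: mult.commute)
qed (use assms in simp)

text \<open>Additivity is applied to \<open>(x \<ominus> \<one>) \<oplus> \<one> = x\<close>, which
  avoids computing the power of \<open>\<ominus> \<one>\<close> and hence a case distinction on the
  parity of \<open>p\<close>.\<close>

lemma (in cring) freshmans_dream_minus:
  assumes "Factorial_Ring.prime (p::nat)" "[p] \<cdot> \<one> = \<zero>" "x \<in> carrier R"
  shows "(x \<ominus> \<one>) [^] (p ^ n) = x [^] (p ^ n) \<ominus> \<one>"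
proof -
  have "x \<ominus> \<one> \<oplus> \<one> = x"
    using assms by algebra
  then have "x [^] (p ^ n) = (x \<ominus> \<one>) [^] (p ^ n) \<oplus> \<one>"
    using freshmans_dream_power[OF assms(1,2), of "x \<ominus> \<one>" \<one> n] assms(3) by simp
  moreover have "(x \<ominus> \<one>) [^] (p ^ n) \<in> carrier R"
    using assms(3) by simp
  ultimately show ?thesis
    using assms(3) by algebra
qed

lemma (in domain) nonzero_pow_nonzero:
  assumes "x \<in> carrier R" "x \<noteq> \<zero>"
  shows "x [^] (n::nat) \<noteq> \<zero>"
  using assms by (induction n) (auto simp: integral_iff)

text \<open>By Lagrange in the additive group of \<open>F\<close>, the order \<open>p ^ m\<close>
  kills \<open>\<one>\<close>. Since \<open>[(p ^ m)] \<cdot> \<one>\<close> is the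
  \<open>m\<close>-th power of \<open>[p] \<cdot> \<one>\<close>, and a field has no nilpotents,
  already \<open>[p] \<cdot> \<one>\<close> vanishes.\<close>

lemma (in field) characteristic_of_finite_subfield:
  assumes F: "subfield F R" and card: "card F = p ^ m" and "p > 0"
  shows "[p] \<cdot> \<one> = \<zero>"
proof -
  have sg: "subgroup F (add_monoid R)"
    using subfieldE(1)[OF F] by (rule subring.axioms)
  interpret A: group "add_monoid R \<lparr>carrier := F\<rparr>"
    using add.subgroup_imp_group[OF sg] .
  have "finite F"
    using card assms(3) by (metis card.infinite power_not_zero gr_implies_not0)
  then have "\<one> [^]\<^bsub>add_monoid R \<lparr>carrier := F\<rparr>\<^esub> (card F) = \<zero>"
    using A.pow_order_eq_1[of \<one>] subringE(3)[OF subfieldE(1)[OF F]] by (simp add: order_def)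
  then have *: "[(p ^ m)] \<cdot> \<one> = \<zero>"
    using card by (simp add: add_pow_def nat_pow_def)
  have "[(p ^ n)] \<cdot> \<one> = ([p] \<cdot> \<one>) [^] n" for n
  proof (induction n)
    case (Suc n)
    have "[(p ^ n * p)] \<cdot> \<one> = [p] \<cdot> ([(p ^ n)] \<cdot> \<one>)"
      by (simp add: add.nat_pow_pow)
    also have "\<dots> = [(p ^ n)] \<cdot> \<one> \<otimes> [p] \<cdot> \<one>"
      by (simp add: add_pow_rdistr)
    finally show ?case
      using Suc.IH by (simp add: mult.commute)
  qed simp
  with * have "([p] \<cdot> \<one>) [^] m = \<zero>"
    by simp
  then show ?thesis
    using nonzero_pow_nonzero[of "[p] \<cdot> \<one>" m] by auto
qed

section \<open>Roots of unity\<close>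

text \<open>These elements are roots of the polynomial X^d - 1, which has at most \<open>d\<close>
  roots.\<close>

lemma (in field) roots_of_unity_bound:
  fixes d :: nat
  assumes "d \<noteq> 0"
  shows "finite {x \<in> carrier R. x [^] d = \<one>}" "card {x \<in> carrier R. x [^] d = \<one>} \<le> d"
proof -
  obtain e where d: "d = Suc e"
    using assms by (cases d) auto
  \<comment> \<open>Coefficient lists start with the leading coefficient: appending
    \<open>\<ominus> \<one>\<close> to the list of X^e gives X^(e+1) - 1.\<close>
  let ?f = "monom \<one> e @ [\<ominus> \<one>]"
  have f: "?f \<in> carrier (poly_ring R)"
    unfolding univ_poly_carrier[symmetric] polynomial_def monom_def by auto
  have deg: "degree ?f = d"
    by (simp add: monom_def d)
  have "x \<in># roots ?f" if "x \<in> carrier R" "x [^] d = \<one>" for x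
  proof -
    have "eval ?f x = \<one> \<otimes> x [^] e \<otimes> x \<oplus> \<ominus> \<one>"
      using that(1) eval_append_aux[of "monom \<one> e" "\<ominus> \<one>" x] monom_in_carrier
      by (simp add: eval_monom)
    also have "\<dots> = \<zero>"
      using that by (simp add: d r_neg)
    finally show ?thesis
      using that(1) unfolding roots_mem_iff_is_root[OF f] is_root_def by (simp add: monom_def)
  qed
  then have sub: "{x \<in> carrier R. x [^] d = \<one>} \<subseteq> set_mset (roots ?f)"
    by auto
  then show "finite {x \<in> carrier R. x [^] d = \<one>}"
    by (rule finite_subset) simp
  have "card {x \<in> carrier R. x [^] d = \<one>} \<le> card (set_mset (roots ?f))"
    using sub by (intro card_mono) auto
  also have "\<dots> \<le> size (roots ?f)"
    by (metis mset_set_set_mset_msubset size_mset_mono size_mset_set)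
  also have "\<dots> \<le> d"
    using size_roots_le_degree[OF f] deg by simp
  finally show "card {x \<in> carrier R. x [^] d = \<one>} \<le> d" .
qed

text \<open>The \<open>card F - 1\<close> nonzero elements of \<open>F\<close> are all roots of
  X^(card F - 1) - 1. By the bound on the number of roots there is no further root in the whole
  field.\<close>

lemma (in field) root_of_unity_in_finite_subfield:
  assumes F: "subfield F R" and fin: "finite F" and dvd: "d dvd card F - 1"
    and x: "x \<in> carrier R" "x [^] (d::nat) = \<one>"
  shows "x \<in> F"
proof -
  let ?n = "card F - 1"
  interpret F: field "R \<lparr>carrier := F\<rparr>"
    using subfield_iff(2)[OF F] .
  have zero: "\<zero> \<in> F" and sub: "F \<subseteq> carrier R" and one: "\<one> \<in> F"
    using subringE[OF subfieldE(1)[OF F]] by auto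
  have card: "card (F - {\<zero>}) = ?n"
    using zero fin by simp
  have "\<one> \<in> F - {\<zero>}"
    using one by simp
  then have n: "?n \<noteq> 0"
    using fin card by (metis card_0_eq empty_iff finite_Diff)
  have units: "Units (R \<lparr>carrier := F\<rparr>) = F - {\<zero>}"
    using F.field_Units by simp
  have "F - {\<zero>} \<subseteq> {y \<in> carrier R. y [^] ?n = \<one>}"
    using F.units_power_order_eq_one fin sub
    by (auto simp: units card nat_pow_consistent[symmetric])
  then have "F - {\<zero>} = {y \<in> carrier R. y [^] ?n = \<one>}"
    using roots_of_unity_bound[OF n] card by (intro card_seteq) auto
  moreover have "x [^] ?n = \<one>"
  proof -
    obtain k where "?n = d * k" using dvd by auto
    then show ?thesis
      using nat_pow_pow[OF x(1), of d k] x(2) by simp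
  qed
  ultimately show ?thesis
    using x(1) by blast
qed

section \<open>Membership criteria for subfields\<close>

lemma (in ring) subfield_pow_closed:
  assumes "subfield K R" "x \<in> K"
  shows "x [^] (n::nat) \<in> K"
  using subringE(3,6)[OF subfieldE(1)[OF assms(1)]] assms(2) by (induction n) auto

lemma (in field) mem_subfield_of_mult:
  assumes K: "subfield K R" and x: "x \<in> carrier R" and y: "y \<in> K" "y \<noteq> \<zero>" and xy: "x \<otimes> y \<in> K"
  shows "x \<in> K"
proof -
  have "y \<in> Units R"
    using K y subringE(1)[OF subfieldE(1)] field_Units by auto
  moreover have "x \<otimes> y \<otimes> inv y \<in> K"
    using subfield_m_inv(1)[OF K] y xy subringE(6)[OF subfieldE(1)[OF K]] by auto
  ultimately show ?thesis
    using x by (simp add: m_assoc Units_closed)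
qed

text \<open>For nonzero \<open>y\<close> the quotient of \<open>x\<close> by \<open>y\<close> is an
  \<open>n\<close>-th root of unity, hence in \<open>K\<close>. This turns each equality of (q-1)-st
  powers between tower generators into a membership.\<close>

lemma (in field) mem_subfield_of_pow_eq:
  assumes K: "subfield K R" and roots: "\<And>z. z \<in> carrier R \<Longrightarrow> z [^] n = \<one> \<Longrightarrow> z \<in> K"
    and x: "x \<in> carrier R" and y: "y \<in> K" and eq: "x [^] n = y [^] n" and n: "(n::nat) \<noteq> 0"
  shows "x \<in> K"
proof (cases "y = \<zero>")
  case True
  then have "x [^] n = \<zero>"
    using eq n by (simp add: nat_pow_zero)
  then show ?thesis
    using nonzero_pow_nonzero[OF x] True y by auto
next
  case False
  have yc: "y \<in> carrier R"
    using K y subringE(1)[OF subfieldE(1)] by auto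
  then have i: "inv y \<in> carrier R" "y \<otimes> inv y = \<one>"
    using False by (auto simp: field_Units)
  have "(x \<otimes> inv y) [^] n = (y \<otimes> inv y) [^] n"
    using x yc i(1) eq by (simp only: nat_pow_distrib)
  then have "x \<otimes> inv y \<in> K"
    using roots x i by simp
  then have "x \<otimes> inv y \<otimes> y \<in> K"
    using y subringE(6)[OF subfieldE(1)[OF K]] by auto
  then show ?thesis
    using x yc i by (simp add: m_assoc m_comm[of "inv y"])
qed

section \<open>The fields generated by the towers\<close>

text \<open>The universal property of adjunction. Iterated along the towers, it reduces an inclusion
  of fields to membership of generators.\<close>

lemma (in field) adjoin_subset_iff:
  assumes "K \<subseteq> carrier R" "x \<in> carrier R" "subfield E R"
  shows "adjoin R K x \<subseteq> E \<longleftrightarrow> K \<subseteq> E \<and> x \<in> E"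
  using assms generate_fieldE(2)[of "insert x K"] generate_field_min_subfield1[of "insert x K" E]
  unfolding adjoin_def by auto

lemma (in field) subfield_adjoin:
  assumes "K \<subseteq> carrier R" "x \<in> carrier R"
  shows "subfield (adjoin R K x) R"
  using assms unfolding adjoin_def by (intro generate_field_is_subfield) auto

lemma (in field) subfield_tower_C:
  assumes F: "subfield F R" and c: "\<And>n. n \<ge> 1 \<Longrightarrow> c n \<in> carrier R"
  shows "subfield (tower_C R F c n) R"
proof (induction n)
  case (Suc n)
  then show ?case
    using subfieldE(3) c by (auto intro!: subfield_adjoin)
qed (use F in simp)

lemma (in field) tower_C_subset_iff:
  assumes F: "subfield F R" and c: "\<And>n. n \<ge> 1 \<Longrightarrow> c n \<in> carrier R" and E: "subfield E R"
  shows "tower_C R F c n \<subseteq> E \<longleftrightarrow> F \<subseteq> E \<and> (\<forall>i\<in>{1..n}. c i \<in> E)"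
proof (induction n)
  case (Suc n)
  have "tower_C R F c n \<subseteq> carrier R"
    by (rule subfieldE(3), rule subfield_tower_C) (use F c in auto)
  then show ?case
    using adjoin_subset_iff[OF _ c[of "Suc n"] E, of "tower_C R F c n"] Suc.IH
    by (auto simp: atLeastAtMostSuc_conv)
qed simp

lemma (in field) subfield_tower_GH:
  assumes F: "subfield F R" and a: "\<And>n. n \<ge> 1 \<Longrightarrow> a n \<in> carrier R"
    and b: "\<And>n. n \<ge> 1 \<Longrightarrow> b n \<in> carrier R"
  shows "subfield (tower_G R F a b (Suc n)) R" "subfield (tower_H R F a b (Suc n)) R"
proof (induction n)
  case 0
  show 1: "subfield (tower_G R F a b (Suc 0)) R"
    using subfieldE(3)[OF F] a by (auto intro!: subfield_adjoin)
  show "subfield (tower_H R F a b (Suc 0)) R"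
    using subfieldE(3)[OF 1] b by (auto intro!: subfield_adjoin)
next
  case (Suc n)
  show 1: "subfield (tower_G R F a b (Suc (Suc n))) R"
    unfolding tower_G.simps using subfieldE(3)[OF Suc(2)] a by (intro subfield_adjoin) auto
  show "subfield (tower_H R F a b (Suc (Suc n))) R"
    unfolding tower_H.simps(1)[of _ _ _ _ "Suc (Suc n)"]
    using subfieldE(3)[OF 1] b by (intro subfield_adjoin) auto
qed

text \<open>The index is \<open>Suc n\<close> because the field at index 0 would involve
  \<open>b 0\<close>, about which nothing is assumed.\<close>

lemma (in field) tower_H_subset_iff:
  assumes F: "subfield F R" and a: "\<And>n. n \<ge> 1 \<Longrightarrow> a n \<in> carrier R"
    and b: "\<And>n. n \<ge> 1 \<Longrightarrow> b n \<in> carrier R" and E: "subfield E R"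
  shows "tower_H R F a b (Suc n) \<subseteq> E \<longleftrightarrow> F \<subseteq> E \<and> (\<forall>i\<in>{1..Suc n}. a i \<in> E \<and> b i \<in> E)"
proof (induction n)
  case 0
  have "tower_G R F a b 1 \<subseteq> carrier R"
    using subfieldE(3)[OF F] a[of 1] subfieldE(3)[OF subfield_adjoin] by simp
  then show ?case
    using adjoin_subset_iff[OF subfieldE(3)[OF F] a[of 1] E]
      adjoin_subset_iff[OF _ b[of 1] E, of "tower_G R F a b 1"] by auto
next
  case (Suc n)
  have H: "tower_H R F a b (Suc n) \<subseteq> carrier R"
    by (rule subfieldE(3), rule subfield_tower_GH) (use F a b in auto)
  have G: "tower_G R F a b (Suc (Suc n)) \<subseteq> carrier R"
    by (rule subfieldE(3), rule subfield_tower_GH) (use F a b in auto)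
  have "tower_H R F a b (Suc (Suc n)) \<subseteq> E \<longleftrightarrow>
      tower_H R F a b (Suc n) \<subseteq> E \<and> a (Suc (Suc n)) \<in> E \<and> b (Suc (Suc n)) \<in> E"
    using adjoin_subset_iff[OF G b[of "Suc (Suc n)"] E] adjoin_subset_iff[OF H a[of "Suc (Suc n)"] E]
    by auto
  then show ?case
    unfolding Suc.IH by (auto simp: atLeastAtMostSuc_conv)
qed

section \<open>Identities between consecutive levels\<close>

lemma (in field) mult_inv_cancel:
  assumes "x \<in> carrier R" "y \<in> carrier R" "y \<noteq> \<zero>"
  shows "x \<otimes> inv y \<otimes> y = x"
proof -
  have "y \<in> Units R" using assms field_Units by simp
  then show ?thesis using assms by (simp add: m_assoc)
qed

lemma (in field) kummer_a_eq:
  assumes "a \<in> carrier R" "a \<noteq> \<zero>" "c \<in> carrier R" "c [^] (n::nat) = \<one> \<ominus> inv a"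
  shows "c [^] n \<otimes> a = a \<ominus> \<one>"
proof -
  have i: "inv a \<in> carrier R" "inv a \<otimes> a = \<one>"
    using assms field_Units by auto
  have "(\<one> \<ominus> inv a) \<otimes> a = a \<ominus> inv a \<otimes> a"
    using assms(1) i(1) by algebra
  then show ?thesis
    using assms(4) i(2) by simp
qed

text \<open>Multiplied by \<open>a'\<close>, both sides become \<open>a' \<ominus> \<one>\<close>.
  In the application \<open>Suc m\<close> is q, \<open>r\<close> is (a^q + a - 1)/a for the previous
  level, and primes mark the next level.\<close>

lemma (in field) kummer_c_eq:
  assumes a: "a' \<in> carrier R" "a' \<noteq> \<zero>" and r: "r \<in> carrier R"
    and rel: "\<one> \<ominus> a' = r \<otimes> a' [^] Suc m"
    and b: "b \<in> carrier R" "b [^] m = \<ominus> r"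
    and c: "c' \<in> carrier R" "c' [^] m = \<one> \<ominus> inv a'"
  shows "c' [^] (m::nat) = (b \<otimes> a') [^] m"
proof -
  have "(b \<otimes> a') [^] m \<otimes> a' = \<ominus> r \<otimes> a' [^] m \<otimes> a'"
    using a b by (simp add: nat_pow_distrib)
  also have "\<dots> = \<ominus> (r \<otimes> a' [^] Suc m)"
    using a r by (simp add: m_assoc l_minus)
  also have "\<dots> = a' \<ominus> \<one>"
    unfolding rel[symmetric] using a by algebra
  also have "\<dots> = c' [^] m \<otimes> a'"
    using kummer_a_eq[OF a c] by simp
  finally show ?thesis
    using a b(1) c(1) by (simp add: m_rcancel)
qed

text \<open>Multiplied by \<open>a \<otimes> a'\<close>, both sides become (a^q - 1) a'^q with q =
  \<open>Suc m\<close>. On the left this follows from the recursion, on the right from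
  \<open>frob\<close> and c^(q-1) a = a - 1.\<close>

lemma (in field) kummer_b_eq:
  assumes a: "a \<in> carrier R" "a \<noteq> \<zero>" and a': "a' \<in> carrier R" "a' \<noteq> \<zero>"
    and rel: "\<one> \<ominus> a' = (a [^] Suc m \<oplus> a \<ominus> \<one>) \<otimes> inv a \<otimes> a' [^] Suc m"
    and b: "b' \<in> carrier R" "b' [^] m = \<ominus> ((a' [^] Suc m \<oplus> a' \<ominus> \<one>) \<otimes> inv a')"
    and c: "c \<in> carrier R" "c [^] m = \<one> \<ominus> inv a"
    and frob: "(a \<ominus> \<one>) [^] Suc m = a [^] Suc m \<ominus> \<one>"
  shows "b' [^] (m::nat) = (c [^] Suc m \<otimes> (a \<otimes> a')) [^] m"
proof -
  define u v where "u = a [^] Suc m" and "v = a' [^] Suc m"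
  have cl: "u \<in> carrier R" "v \<in> carrier R" "inv a \<in> carrier R" "inv a' \<in> carrier R"
    using a a' field_Units unfolding u_def v_def by auto
  have rel': "(\<one> \<ominus> a') \<otimes> a = (u \<oplus> a \<ominus> \<one>) \<otimes> v"
  proof -
    have "(\<one> \<ominus> a') \<otimes> a = ((u \<oplus> a \<ominus> \<one>) \<otimes> inv a \<otimes> a) \<otimes> v"
      unfolding rel u_def[symmetric] v_def[symmetric] using a cl by (simp add: m_ac)
    then show ?thesis
      using mult_inv_cancel[OF _ a, of "u \<oplus> a \<ominus> \<one>"] a cl by simp
  qed
  have "b' [^] m \<otimes> a' = \<ominus> ((v \<oplus> a' \<ominus> \<one>) \<otimes> inv a' \<otimes> a')"
    unfolding b(2) v_def[symmetric] using a' cl by (simp add: l_minus)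
  also have "\<dots> = \<ominus> (v \<oplus> a' \<ominus> \<one>)"
    using mult_inv_cancel[OF _ a', of "v \<oplus> a' \<ominus> \<one>"] a' cl by simp
  finally have "b' [^] m \<otimes> (a \<otimes> a') = \<ominus> (v \<oplus> a' \<ominus> \<one>) \<otimes> a"
    using a a' b(1) by (metis m_assoc m_comm nat_pow_closed)
  also have "\<dots> = (\<one> \<ominus> a') \<otimes> a \<ominus> v \<otimes> a"
    using a a' cl by algebra
  \<comment> \<open>Replacing \<open>(\<one> \<ominus> a') \<otimes> a\<close> by the recursion
    cancels \<open>v \<otimes> a\<close>, so \<open>a\<close> survives only through
    \<open>u\<close>, its q-th power.\<close>
  also have "\<dots> = (u \<ominus> \<one>) \<otimes> v"
    unfolding rel' using a cl by algebra
  also have "\<dots> = (c [^] m \<otimes> a) [^] Suc m \<otimes> a' [^] Suc m"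
    unfolding kummer_a_eq[OF a c] frob u_def v_def ..
  also have "\<dots> = (c [^] m) [^] Suc m \<otimes> (a \<otimes> a') [^] Suc m"
    using a a' c(1) by (simp only: nat_pow_distrib nat_pow_closed m_closed m_assoc)
  also have "(c [^] m) [^] Suc m = (c [^] Suc m) [^] m"
    using c(1) by (simp only: nat_pow_pow mult.commute)
  \<comment> \<open>One of the q factors \<open>a \<otimes> a'\<close> is split off, to be cancelled
    against the one introduced on the left; the rest is a perfect \<open>m\<close>-th power.\<close>
  also have "(c [^] Suc m) [^] m \<otimes> (a \<otimes> a') [^] Suc m = (c [^] Suc m \<otimes> (a \<otimes> a')) [^] m \<otimes> (a \<otimes> a')"
    using a a' c(1) by (simp add: nat_pow_distrib m_assoc)
  finally show ?thesis
    using a a' b(1) c(1) by (simp add: m_rcancel integral_iff)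
qed

section \<open>Comparison of the two towers\<close>

theorem mainTheorem1:
  fixes L :: "('a, 'm) ring_scheme" (structure)
    and F :: "'a set"
    and q l :: nat
    and a b c :: "nat \<Rightarrow> 'a"
  assumes "primepow q"
    and "l = q ^ 3"
    and "subfield F L"
    and "card F = l"
    and "a 1 \<in> carrier L"
    and "(ring.transcendental L over F) (a 1)"
    and "algebraic_closure L (adjoin L F (a 1))"
    and "\<And>n. n \<ge> 1 \<Longrightarrow> a n \<in> carrier L - {\<zero>}"
    and "\<And>n. n \<ge> 1 \<Longrightarrow> b n \<in> carrier L"
    and "\<And>n. n \<ge> 1 \<Longrightarrow> c n \<in> carrier L"
    and "\<And>n. n \<ge> 1 \<Longrightarrow>
           (\<one> \<ominus> a (n + 1)) \<otimes> inv (a (n + 1) [^] q)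
             = ((a n [^] q \<oplus> a n) \<ominus> \<one>) \<otimes> inv (a n)"
    and "\<And>n. n \<ge> 1 \<Longrightarrow> c n [^] (q - 1) = \<one> \<ominus> inv (a n)"
    and "\<And>n. n \<ge> 1 \<Longrightarrow>
           b n [^] (q - 1) = \<ominus> (((a n [^] q \<oplus> a n) \<ominus> \<one>) \<otimes> inv (a n))"
  shows "\<forall>n\<ge>2. tower_H L F a b n = tower_C L F c n"
proof -
  interpret algebraic_closure L "adjoin L F (a 1)"
    by fact
  note F = \<open>subfield F L\<close>
  obtain p k where p: "Factorial_Ring.prime p" and k: "k > 0" and q: "q = p ^ k"
    using \<open>primepow q\<close> unfolding primepow_def by auto
  define m where "m = q - 1"
  have "q > 1"
    using one_less_power[OF prime_gt_1_nat[OF p] k] q by simp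
  then have qm: "q = Suc m" and m: "m \<noteq> 0" and qm1: "q - 1 = m"
    unfolding m_def by auto
  have card: "card F = p ^ (k * 3)"
    using assms(2,4) q by (simp add: power_mult)
  have char: "[p] \<cdot> \<one> = \<zero>"
    using characteristic_of_finite_subfield[OF F card] prime_gt_0_nat[OF p] .
  have "finite F"
    using card prime_gt_0_nat[OF p] by (metis card.infinite power_not_zero gr_implies_not0)
  moreover have "m dvd card F - 1"
  proof -
    \<comment> \<open>This is q^3 - 1 = (q - 1)(q^2 + q + 1) rewritten with q = m + 1.\<close>
    have "card F - 1 = m * (m * m + 3 * m + 3)"
      unfolding assms(2,4) qm by (simp add: algebra_simps power3_eq_cube)
    then show ?thesis by simp
  qed
  ultimately have roots: "z \<in> F" if "z \<in> carrier L" "z [^] m = \<one>" for z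
    using root_of_unity_in_finite_subfield[OF F] that by blast
  have a: "a n \<in> carrier L" "a n \<noteq> \<zero>" if "n \<ge> 1" for n
    using assms(8)[OF that] by auto
  note b = assms(9) and c = assms(10)
  have c_pow: "c n [^] m = \<one> \<ominus> inv (a n)" if "n \<ge> 1" for n
    using assms(12)[OF that] unfolding qm1 .
  have b_pow: "b n [^] m = \<ominus> ((a n [^] Suc m \<oplus> a n \<ominus> \<one>) \<otimes> inv (a n))" if "n \<ge> 1" for n
    using assms(13)[OF that] unfolding qm1 unfolding qm .
  have r: "(a n [^] Suc m \<oplus> a n \<ominus> \<one>) \<otimes> inv (a n) \<in> carrier L" if "n \<ge> 1" for n
    using a[OF that] field_Units by auto
  have rel: "\<one> \<ominus> a (Suc n) = (a n [^] Suc m \<oplus> a n \<ominus> \<one>) \<otimes> inv (a n) \<otimes> a (Suc n) [^] Suc m"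
    if "n \<ge> 1" for n
  proof -
    have "(\<one> \<ominus> a (Suc n)) \<otimes> inv (a (Suc n) [^] Suc m) \<otimes> a (Suc n) [^] Suc m = \<one> \<ominus> a (Suc n)"
      using a[of "Suc n"] nonzero_pow_nonzero[of "a (Suc n)" "Suc m"] by (intro mult_inv_cancel) auto
    then show ?thesis
      using assms(11)[OF that] unfolding qm by simp
  qed
  have c_eq: "c (Suc n) [^] m = (b n \<otimes> a (Suc n)) [^] m" if "n \<ge> 1" for n
    using that a[of "Suc n"] b c b_pow c_pow by (intro kummer_c_eq[OF _ _ r rel]) auto
  have b_eq: "b (Suc n) [^] m = (c n [^] Suc m \<otimes> (a n \<otimes> a (Suc n))) [^] m" if "n \<ge> 1" for n
  proof -
    have "(a n \<ominus> \<one>) [^] Suc m = a n [^] Suc m \<ominus> \<one>"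
      using freshmans_dream_minus[OF p char a(1)[OF that], of k] unfolding q[symmetric] qm .
    then show ?thesis
      using that a[of n] a[of "Suc n"] b c b_pow c_pow
      by (intro kummer_b_eq rel) (auto simp del: nat_pow_Suc)
  qed
  have subfield_C: "subfield (tower_C L F c n) L" for n
    by (rule subfield_tower_C) (use F c in auto)
  have C_iff: "tower_C L F c n \<subseteq> E \<longleftrightarrow> F \<subseteq> E \<and> (\<forall>i\<in>{1..n}. c i \<in> E)"
    if "subfield E L" for E n
    by (rule tower_C_subset_iff) (use F c that in auto)
  have subfield_H: "subfield (tower_H L F a b (Suc n)) L" for n
    by (rule subfield_tower_GH) (use F a b in auto)
  have H_iff: "tower_H L F a b (Suc n) \<subseteq> E \<longleftrightarrow> F \<subseteq> E \<and> (\<forall>i\<in>{1..Suc n}. a i \<in> E \<and> b i \<in> E)"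
    if "subfield E L" for E n
    by (rule tower_H_subset_iff) (use F a b that in auto)
  show ?thesis
  proof (intro allI impI)
    fix n :: nat assume n: "n \<ge> 2"
    then obtain n' where n': "n = Suc n'" by (cases n) auto
    have "tower_H L F a b n \<subseteq> tower_C L F c n"
    proof -
      let ?K = "tower_C L F c n"
      have K: "subfield ?K L"
        using subfield_C .
      \<comment> \<open>Taking the field itself for \<open>E\<close> in \<open>C_iff\<close> makes
        the inclusion trivial and yields membership of all generators.\<close>
      have sub: "F \<subseteq> ?K" and cK: "\<And>i. i \<in> {1..n} \<Longrightarrow> c i \<in> ?K"
        using C_iff[OF K, of n] by auto
      note Kc = subringE[OF subfieldE(1)[OF K]]
      have eqK: "x \<in> ?K" if "x \<in> carrier L" "y \<in> ?K" "x [^] m = y [^] m" for x y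
        using mem_subfield_of_pow_eq[OF K _ that m] sub roots by blast
      \<comment> \<open>The defining equation of \<open>c i\<close> can be solved for a_i = 1/(1 -
        c_i^(q-1)).\<close>
      have aK: "a i \<in> ?K" if i: "i \<in> {1..n}" for i
      proof -
        have u: "a i \<in> Units L"
          using a i field_Units by simp
        have "inv (a i) = \<one> \<ominus> c i [^] m"
        proof -
          have "inv (a i) = \<one> \<ominus> (\<one> \<ominus> inv (a i))"
            using Units_inv_closed[OF u] by algebra
          then show ?thesis
            using c_pow[of i] i by simp
        qed
        then have "inv (a i) \<in> ?K"
          using Kc subfield_pow_closed[OF K cK[OF i]] unfolding a_minus_def by simp
        moreover have "inv (a i) \<noteq> \<zero>"
          using u Units_inv_Units field_Units by auto
        ultimately have "inv (inv (a i)) \<in> ?K"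
          using subfield_m_inv(1)[OF K] by auto
        then show ?thesis
          using u by simp
      qed
      have "b i \<in> ?K" if i: "i \<in> {1..n}" for i
      proof (cases "i = 1")
        case True
        \<comment> \<open>No level precedes the first, so \<open>b 1\<close> is reached from above:
          the relation between \<open>c 2\<close> and \<open>b 1 \<otimes> a 2\<close> is available
          because \<open>n \<ge> 2\<close>.\<close>
        have "c 2 \<in> ?K" "a 2 \<in> ?K" "c 2 [^] m = (b 1 \<otimes> a 2) [^] m"
          using cK aK n c_eq[of 1] by (auto simp: numeral_2_eq_2)
        then have "b 1 \<otimes> a 2 \<in> ?K"
          using eqK[of "b 1 \<otimes> a 2" "c 2"] a[of 2] b[of 1] by simp
        then show ?thesis
          using mem_subfield_of_mult[OF K b[of 1] \<open>a 2 \<in> ?K\<close>] a[of 2] True by simp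
      next
        case False
        then obtain j where j: "i = Suc j" "j \<in> {1..n}"
          using i by (cases i) auto
        \<comment> \<open>For \<open>i > 1\<close> the element of \<open>?K\<close> with the same
          \<open>m\<close>-th power as \<open>b i\<close> comes from level
          \<open>j = i - 1\<close>.\<close>
        then have "c j [^] Suc m \<otimes> (a j \<otimes> a i) \<in> ?K"
          using Kc(6) aK i subfield_pow_closed[OF K cK] by blast
        then show ?thesis
          using eqK[OF b _ b_eq[of j]] i j by simp
      qed
      then show ?thesis
        using H_iff[OF K, of n'] sub aK n' by auto
    qed
    moreover have "tower_C L F c n \<subseteq> tower_H L F a b n"
    proof -
      let ?K = "tower_H L F a b n"
      have K: "subfield ?K L"
        using subfield_H[of n'] unfolding n' .
      have sub: "F \<subseteq> ?K" and aK: "\<And>i. i \<in> {1..n} \<Longrightarrow> a i \<in> ?K"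
        and bK: "\<And>i. i \<in> {1..n} \<Longrightarrow> b i \<in> ?K"
        using H_iff[OF K, of n'] n' by auto
      note Kc = subringE[OF subfieldE(1)[OF K]]
      have eqK: "x \<in> ?K" if "x \<in> carrier L" "y \<in> ?K" "x [^] m = y [^] m" for x y
        using mem_subfield_of_pow_eq[OF K _ that m] sub roots by blast
      have "c i \<in> ?K" if i: "i \<in> {1..n}" for i
      proof (cases "i = 1")
        case True
        show ?thesis
        proof (cases "c 1 = \<zero>")
          case True
          \<comment> \<open>Handled apart because the argument below divides by a power of
            \<open>c 1\<close>.\<close>
          then show ?thesis using Kc \<open>i = 1\<close> by simp
        next
          case False
          have aa: "a 1 \<otimes> a 2 \<in> ?K" "a 1 \<otimes> a 2 \<noteq> \<zero>"
            using Kc(6) aK n a[of 1] a[of 2] by (auto simp: integral_iff)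
          \<comment> \<open>Here \<open>n \<ge> 2\<close> enters: \<open>b 2\<close> lies in
            \<open>?K\<close> and has the same \<open>m\<close>-th power as
            \<open>c 1 [^] Suc m \<otimes> (a 1 \<otimes> a 2)\<close>.\<close>
          have "b 2 \<in> ?K" "b 2 [^] m = (c 1 [^] Suc m \<otimes> (a 1 \<otimes> a 2)) [^] m"
            using bK n b_eq[of 1] by (auto simp: numeral_2_eq_2)
          then have "c 1 [^] Suc m \<otimes> (a 1 \<otimes> a 2) \<in> ?K"
            using eqK[of "c 1 [^] Suc m \<otimes> (a 1 \<otimes> a 2)" "b 2"] a[of 1] a[of 2] c[of 1] by simp
          then have "c 1 [^] Suc m \<in> ?K"
            using mem_subfield_of_mult[OF K _ aa] c[of 1] by simp
          \<comment> \<open>The q-th power of \<open>c 1\<close> is \<open>c 1\<close> times its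
            (q-1)-st power. The latter equals 1 - 1/a_1, which lies in \<open>?K\<close>, so it can
            be divided out.\<close>
          then have "c 1 \<otimes> c 1 [^] m \<in> ?K"
            using c[of 1] by (simp add: m_comm)
          moreover have "inv (a 1) \<in> ?K"
            using aK[of 1] a[of 1] n subfield_m_inv(1)[OF K] by auto
          then have "c 1 [^] m \<in> ?K"
            using c_pow[of 1] Kc(3,5,7) unfolding a_minus_def by simp
          moreover have "c 1 [^] m \<noteq> \<zero>"
            using False c[of 1] nonzero_pow_nonzero by auto
          ultimately show ?thesis
            using mem_subfield_of_mult[OF K c[of 1]] \<open>i = 1\<close> by simp
        qed
      next
        case False
        then obtain j where j: "i = Suc j" "j \<in> {1..n}"
          using i by (cases i) auto
        \<comment> \<open>For \<open>i > 1\<close> the product \<open>b j \<otimes> a i\<close> with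
          \<open>j = i - 1\<close> has the same \<open>m\<close>-th power as
          \<open>c i\<close>.\<close>
        then have "b j \<otimes> a i \<in> ?K"
          using Kc(6) aK bK i by blast
        then show ?thesis
          using eqK[OF c _ c_eq[of j]] i j by simp
      qed
      then show ?thesis
        using C_iff[OF K, of n] sub by auto
    qed
    ultimately show "tower_H L F a b n = tower_C L F c n" ..
  qed
qed

end
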